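(* Let $(X,d)$ be a connected Polish space and let $(\Omega,\mathcal{F},\mathbb{P},\theta,\varphi)$ be a pullback continuous (continuous-time) random dynamical system on $X$. If there exists a pullback attractor $A$ of $\varphi$, then $A(\omega)$ is connected for $\mathbb{P}$-almost every $\omega\in\Omega$.
   Context: Polish space means separable complete metric space $(X,d)$, with Borel $\sigma$-algebra $\mathcal{B}(X)$. A metric dynamical system $(\Omega,\mathcal{F},\mathbb{P},\theta)$ is a probability space $(\Omega,\mathcal{F},\mathbb{P})$ with a group $(\theta_t)_{t\in\mathbb{R}}$ of maps $\Omega\to\Omega$ such that $(t,\omega)\mapsto\theta_t\omega$ is jointly measurable, $\theta_0=\mathrm{id}$, $\theta_{s+t}=\theta_s\circ\theta_t$, and $\mathbb{P}$ is invariant under every $\theta_t$. A random dynamical system (RDS) $(\Omega,\mathcal{F},\mathbb{P},\theta,\varphi)$ on $X$ is a metric dynamical system together with a jointly measurable map $\varphi:\mathbb{R}_+\times\Omega\times X\to X$, $(t,\omega,x)\mapsto\varphi_t(\omega,x)$, such that for all $s,t\in\mathbb{R}_+$, $\omega\in\Omega$, $x\in X$: $\varphi_0(\omega,x)=x$; $\varphi_{s+t}(\omega,x)=\varphi_t(\theta_s\omega,\varphi_s(\omega,x))$; and $x\mapsto\varphi_t(\omega,x)$ is continuous. The RDS is pullback continuous if $t\mapsto\varphi_t(\theta_{-t}\omega,x)$ is continuous on $\mathbb{R}_+$ for each $\omega\in\Omega$ and $x\in X$. For nonempty $A\subset X$, $d(x,A):=\inf_{a\in A}d(x,a)$. A random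 compact set is a family $\{A(\omega)\}_{\omega\in\Omega}$ of nonempty subsets of $X$ such that $A(\omega)$ is compact for $\mathbb{P}$-almost every $\omega$ and $\omega\mapsto d(x,A(\omega))$ is $\mathcal{F}$-measurable for each $x\in X$. It is $\varphi$-invariant if for every $t\in\mathbb{R}_+$, $\varphi_t(\omega,A(\omega))=A(\theta_t\omega)$ for $\mathbb{P}$-almost every $\omega$. A pullback attractor of the RDS is a random compact set $A$ that is $\varphi$-invariant and such that for every (deterministic) compact set $B\subset X$, $\lim_{t\to\infty}\sup_{x\in B}d(\varphi_t(\theta_{-t}\omega,x),A(\omega))=0$ for $\mathbb{P}$-almost every $\omega$ (the exceptional nullset may depend on $B$). *)

theory Defs
  imports "HOL-Probability.Probability"
begin

locale metric_dynamical_system = prob_space M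
  for M :: "'w measure" +
  fixes \<theta> :: "real \<Rightarrow> 'w \<Rightarrow> 'w"
  assumes measurable_shift:
      "(\<lambda>(t, \<omega>). \<theta> t \<omega>) \<in> measurable (borel \<Otimes>\<^sub>M M) M"
    and shift_0: "\<And>\<omega>. \<omega> \<in> space M \<Longrightarrow> \<theta> 0 \<omega> = \<omega>"
    and shift_add: "\<And>s t \<omega>. \<omega> \<in> space M \<Longrightarrow> \<theta> (s + t) \<omega> = \<theta> s (\<theta> t \<omega>)"
    and shift_invariant: "\<And>t. distr M M (\<theta> t) = M"

text \<open>
  The state space is a type of class \<^class>\<open>polish_space\<close>, that is, a complete metric space with
  a countable base. The time set of \<open>\<phi>\<close> is \<open>{0..}\<close>; values at negative times are unconstrained.
\<close>

locale random_dynamical_system = metric_dynamical_system M \<theta>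
  for M :: "'w measure" and \<theta> :: "real \<Rightarrow> 'w \<Rightarrow> 'w" +
  fixes \<phi> :: "real \<Rightarrow> 'w \<Rightarrow> 'x::polish_space \<Rightarrow> 'x"
  assumes measurable_cocycle:
      "(\<lambda>(t, \<omega>, x). \<phi> t \<omega> x)
        \<in> measurable (restrict_space borel {0..} \<Otimes>\<^sub>M (M \<Otimes>\<^sub>M borel)) borel"
    and cocycle_0: "\<And>\<omega> x. \<omega> \<in> space M \<Longrightarrow> \<phi> 0 \<omega> x = x"
    and cocycle_add: "\<And>s t \<omega> x. s \<ge> 0 \<Longrightarrow> t \<ge> 0 \<Longrightarrow> \<omega> \<in> space M \<Longrightarrow>
        \<phi> (s + t) \<omega> x = \<phi> t (\<theta> s \<omega>) (\<phi> s \<omega> x)"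
    and cocycle_continuous: "\<And>t \<omega>. t \<ge> 0 \<Longrightarrow> \<omega> \<in> space M \<Longrightarrow> continuous_on UNIV (\<phi> t \<omega>)"

definition pullback_continuous ::
    "'w measure \<Rightarrow> (real \<Rightarrow> 'w \<Rightarrow> 'w) \<Rightarrow> (real \<Rightarrow> 'w \<Rightarrow> 'x \<Rightarrow> 'x::polish_space) \<Rightarrow> bool" where
  "pullback_continuous M \<theta> \<phi> \<longleftrightarrow>
    (\<forall>\<omega>\<in>space M. \<forall>x. continuous_on {0..} (\<lambda>t. \<phi> t (\<theta> (- t) \<omega>) x))"

definition random_compact_set :: "'w measure \<Rightarrow> ('w \<Rightarrow> 'x::polish_space set) \<Rightarrow> bool" where
  "random_compact_set M A \<longleftrightarrow>
    (\<forall>\<omega>\<in>space M. A \<omega> \<noteq> {}) \<and>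
    (AE \<omega> in M. compact (A \<omega>)) \<and>
    (\<forall>x. (\<lambda>\<omega>. infdist x (A \<omega>)) \<in> borel_measurable M)"

definition invariant_random_set ::
    "'w measure \<Rightarrow> (real \<Rightarrow> 'w \<Rightarrow> 'w) \<Rightarrow> (real \<Rightarrow> 'w \<Rightarrow> 'x \<Rightarrow> 'x)
      \<Rightarrow> ('w \<Rightarrow> 'x::polish_space set) \<Rightarrow> bool" where
  "invariant_random_set M \<theta> \<phi> A \<longleftrightarrow>
    (\<forall>t\<ge>0. AE \<omega> in M. \<phi> t \<omega> ` A \<omega> = A (\<theta> t \<omega>))"

text \<open>
  The supremum is taken in \<^typ>\<open>ennreal\<close>, so that it is a genuine least upper bound without side
  conditions and equals \<open>0\<close> for \<open>B = {}\<close>.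
\<close>

definition pullback_attractor ::
    "'w measure \<Rightarrow> (real \<Rightarrow> 'w \<Rightarrow> 'w) \<Rightarrow> (real \<Rightarrow> 'w \<Rightarrow> 'x \<Rightarrow> 'x)
      \<Rightarrow> ('w \<Rightarrow> 'x::polish_space set) \<Rightarrow> bool" where
  "pullback_attractor M \<theta> \<phi> A \<longleftrightarrow>
    random_compact_set M A \<and>
    invariant_random_set M \<theta> \<phi> A \<and>
    (\<forall>B. compact B \<longrightarrow>
      (AE \<omega> in M.
        ((\<lambda>t. SUP x\<in>B. ennreal (infdist (\<phi> t (\<theta> (- t) \<omega>) x) (A \<omega>))) \<longlongrightarrow> 0) at_top))"

end

theory Submission
  imports Defs
begin

text \<open>
  Fix \<open>\<omega>\<close> and write \<open>f t x = \<phi> t (\<theta> (- t) \<omega>) x\<close>. Suppose attraction to \<open>A \<omega>\<close> is locally uniform in \<open>x\<close>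
  and \<open>A \<omega>\<close> splits into two nonempty compact parts. By continuity in \<open>t\<close> every trajectory stays
  eventually near only one of the parts, and the two basins are open, so by connectedness of the space
  one basin is everything. Then compact sets are attracted to a single part; but \<open>A \<omega> = f n ` A (\<theta> (- n) \<omega>)\<close>,
  and by tightness and invariance of the measure \<open>A (\<theta> (- n) \<omega>)\<close> lies in a fixed compact set for infinitely
  many \<open>n\<close>, a contradiction.

  Locally uniform attraction amounts to a nullset that serves all compact sets at once. A sequence of
  points of a countable dense set witnessing its failure depends on \<open>\<omega>\<close> and cannot obviously be chosen
  measurably. But outer measure is continuous along increasing unions of arbitrary sets, which
  confines the witnesses, on a set of positive outer measure, to finite sets whose union is totally
  bounded; its closure is a deterministic compact set that is not attracted.
\<close>

section \<open>Connectedness from locally uniform attraction, for one fixed path\<close>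

text \<open>The product filter gives each point of \<open>K\<close> a neighbourhood with its own
  threshold time; a finite subcover leaves only finitely many thresholds to exceed.\<close>

lemma eventually_compact_image_subset:
  fixes f :: "real \<Rightarrow> 'a::topological_space \<Rightarrow> 'b"
  assumes "compact K"
    and "\<And>x. x \<in> K \<Longrightarrow> \<forall>\<^sub>F (t, y) in at_top \<times>\<^sub>F nhds x. f t y \<in> U"
  shows "\<forall>\<^sub>F t in at_top. f t ` K \<subseteq> U"
proof -
  have "\<exists>T S. open S \<and> x \<in> S \<and> (\<forall>t\<ge>T. \<forall>y\<in>S. f t y \<in> U)" if "x \<in> K" for x
    using assms(2)[OF that]
    unfolding eventually_prod_filter eventually_at_top_linorder eventually_nhds
    by (simp, meson)
  then obtain T S where TS: "\<And>x. x \<in> K \<Longrightarrow> open (S x)" "\<And>x. x \<in> K \<Longrightarrow> x \<in> S x"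
      "\<And>x t y. \<lbrakk>x \<in> K; t \<ge> T x; y \<in> S x\<rbrakk> \<Longrightarrow> f t y \<in> U"
    by metis
  obtain C where C: "C \<subseteq> K" "finite C" "K \<subseteq> (\<Union>x\<in>C. S x)"
    by (rule compactE_image[OF assms(1), of K S]) (use TS in auto)
  have "\<forall>\<^sub>F t in at_top. \<forall>x\<in>C. t \<ge> T x"
    using C(2) by (simp add: eventually_ball_finite eventually_ge_at_top)
  then show ?thesis
    by eventually_elim (use C TS(3) in blast)
qed

lemma connected_if_locally_uniformly_attracting:
  fixes f :: "real \<Rightarrow> 'a::metric_space \<Rightarrow> 'a"
  assumes "connected (UNIV :: 'a set)" "compact A"
    and cont_time: "\<And>x. continuous_on {0..} (\<lambda>t. f t x)"
    and cont_space: "\<And>t. t \<ge> 0 \<Longrightarrow> continuous_on UNIV (f t)"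
    and attr: "\<And>x e. e > 0 \<Longrightarrow> \<forall>\<^sub>F (t, y) in at_top \<times>\<^sub>F nhds x. infdist (f t y) A < e"
    and "compact K" and recur: "\<exists>\<^sub>F t in at_top. A \<subseteq> f t ` K"
  shows "connected A"
proof (rule ccontr)
  assume "\<not> connected A"
  then obtain C1 C2 where C: "closed C1" "closed C2" "A \<subseteq> C1 \<union> C2" "C1 \<inter> C2 \<inter> A = {}"
      "C1 \<inter> A \<noteq> {}" "C2 \<inter> A \<noteq> {}"
    unfolding connected_closed by blast
  define A1 where "A1 = C1 \<inter> A"
  define A2 where "A2 = C2 \<inter> A"
  have A12: "closed A1" "closed A2" "A1 \<noteq> {}" "A2 \<noteq> {}" "A1 \<inter> A2 = {}" "A = A1 \<union> A2"
    using C \<open>compact A\<close> by (auto simp: A1_def A2_def intro!: closed_Int compact_imp_closed)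
  \<comment> \<open>Comparing the two distances yields disjoint open neighbourhoods of the parts;
    points equidistant from both lie in neither.\<close>
  define U1 where "U1 = {y. infdist y A1 < infdist y A2}"
  define U2 where "U2 = {y. infdist y A2 < infdist y A1}"
  have U_open: "open U1" "open U2"
    by (auto simp: U1_def U2_def intro!: open_Collect_less continuous_intros)
  have U_disj: "U1 \<inter> U2 = {}" by (auto simp: U1_def U2_def)
  have U_sub: "A1 \<subseteq> U1" "A2 \<subseteq> U2"
    using A12 infdist_pos_not_in_closed[of A1] infdist_pos_not_in_closed[of A2]
    by (fastforce simp: U1_def U2_def)+
  obtain e where e: "e > 0" "(\<Union>x\<in>A. ball x e) \<subseteq> U1 \<union> U2"
    using compact_subset_open_imp_ball_epsilon_subset[OF \<open>compact A\<close>, of "U1 \<union> U2"] U_open U_sub A12(6)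
    by blast
  \<comment> \<open>Nonemptiness of \<open>A\<close> matters here: \<open>infdist\<close> to the
    empty set is 0 by convention.\<close>
  have near: "y \<in> U1 \<union> U2" if "infdist y A < e" for y
  proof -
    have "\<exists>a\<in>A. dist y a < e"
      using that A12 by (auto simp: infdist_notempty cINF_less_iff simp del: Un_iff)
    then show ?thesis using e(2) by (auto simp: dist_commute subset_iff)
  qed
  \<comment> \<open>\<open>V U\<close> is the basin of \<open>U\<close>, with the entry time uniform
    near \<open>x\<close>; this uniformity makes the basin open.\<close>
  define V where "V U = {x. \<forall>\<^sub>F (t, y) in at_top \<times>\<^sub>F nhds x. f t y \<in> U}" for U
  have V_open: "open (V U)" for U
  proof (subst open_subopen, intro ballI)
    fix x assume "x \<in> V U"
    then obtain T S where "open S" "x \<in> S" "\<forall>t\<ge>T. \<forall>y\<in>S. f t y \<in> U"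
      unfolding V_def eventually_prod_filter eventually_at_top_linorder eventually_nhds mem_Collect_eq
      by (simp, meson)
    moreover from this have "S \<subseteq> V U"
      unfolding V_def eventually_prod_filter eventually_at_top_linorder eventually_nhds
      by (auto intro!: exI[of _ "\<lambda>t. t \<ge> T"] exI[of _ "\<lambda>y. y \<in> S"])
    ultimately show "\<exists>S. open S \<and> x \<in> S \<and> S \<subseteq> V U" by blast
  qed
  have V_disj: "V U1 \<inter> V U2 = {}"
  proof safe
    fix x assume "x \<in> V U1" "x \<in> V U2"
    then have "\<forall>\<^sub>F (t, y) in at_top \<times>\<^sub>F nhds x. f t y \<in> U1 \<inter> U2"
      unfolding V_def mem_Collect_eq by eventually_elim auto
    then show "x \<in> {}" using U_disj by (simp add: case_prod_unfold prod_filter_eq_bot)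
  qed
  have V_cover: "V U1 \<union> V U2 = UNIV"
  proof -
    have "x \<in> V U1 \<union> V U2" for x
    proof -
      from attr[OF e(1), of x] obtain T0 S where "open S" "x \<in> S"
        and T0: "\<forall>t\<ge>T0. \<forall>y\<in>S. infdist (f t y) A < e"
        unfolding eventually_prod_filter eventually_at_top_linorder eventually_nhds
        by (simp, meson)
      define T where "T = max T0 0"
      have T: "T \<ge> 0" "\<And>t y. t \<ge> T \<Longrightarrow> y \<in> S \<Longrightarrow> f t y \<in> U1 \<union> U2"
        using T0 near by (auto simp: T_def)
      \<comment> \<open>From time \<open>T\<close> on, the trajectory is a connected set inside the
        disjoint open sets \<open>U1\<close> and \<open>U2\<close>, so it cannot change
        sides.\<close>
      have dich: "U1 \<inter> (\<lambda>t. f t y) ` {T..} = {} \<or> U2 \<inter> (\<lambda>t. f t y) ` {T..} = {}" if "y \<in> S" for y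
      proof (rule connectedD[OF _ U_open])
        show "connected ((\<lambda>t. f t y) ` {T..})"
          by (intro connected_continuous_image continuous_on_subset[OF cont_time])
             (use T(1) in auto)
      qed (use U_disj T(2)[OF _ that] in auto)
      \<comment> \<open>The side is decided at the single time \<open>T\<close>; continuity of
        \<open>f T\<close> in space makes nearby points choose the same side.\<close>
      have stay: "x \<in> V U" if "f T x \<in> U" "open U" 
        "\<And>y. y \<in> S \<Longrightarrow> f T y \<in> U \<Longrightarrow> \<forall>t\<ge>T. f t y \<in> U" for U
      proof -
        have "open (f T -` U \<inter> S)"
          using cont_space[OF T(1)] \<open>open S\<close> \<open>open U\<close> by (auto intro!: open_Int open_vimage)
        then have "\<forall>\<^sub>F y in nhds x. y \<in> f T -` U \<inter> S"
          using \<open>f T x \<in> U\<close> \<open>x \<in> S\<close> by (intro eventually_nhds_in_open) auto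
        with eventually_ge_at_top[of T] show ?thesis
          unfolding V_def eventually_prod_filter using that(3) by blast
      qed
      show ?thesis
      proof (cases "f T x \<in> U1")
        case True
        have "x \<in> V U1"
          by (rule stay[OF True U_open(1)]) (use dich T U_disj in fastforce)
        then show ?thesis ..
      next
        case False
        then have "f T x \<in> U2" using T(2) \<open>x \<in> S\<close> by auto
        then have "x \<in> V U2"
          by (rule stay[OF _ U_open(2)]) (use dich T U_disj in fastforce)
        then show ?thesis ..
      qed
    qed
    then show ?thesis by blast
  qed
  \<comment> \<open>If one basin were everything, \<open>K\<close> would eventually be mapped into
    \<open>U\<close>, and then \<open>recur\<close> would force all of \<open>A\<close> into
    \<open>U\<close>.\<close>
  have contra: False if "V U = UNIV" "\<not> A \<subseteq> U" for U
  proof -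
    have "\<forall>\<^sub>F t in at_top. f t ` K \<subseteq> U"
      by (rule eventually_compact_image_subset[OF \<open>compact K\<close>]) (use that V_def in auto)
    then have "\<forall>\<^sub>F t in at_top. \<not> A \<subseteq> f t ` K"
      by eventually_elim (use that(2) in blast)
    with recur show False by (simp add: frequently_def)
  qed
  have "V U1 = {} \<or> V U2 = {}"
    using connectedD[OF assms(1) V_open V_open, of U1 U2] V_disj V_cover by auto
  moreover have "\<not> A \<subseteq> U1" "\<not> A \<subseteq> U2"
    using A12 U_sub U_disj by blast+
  ultimately show False using contra V_cover by blast
qed

section \<open>Outer measure, upper limits of events and total boundedness\<close>

text \<open>The coordinates are bounded one after another: the sets cut out by \<open>b\<close>
  increase to the current set, and outer measure is continuous along such unions even for
  nonmeasurable sets, so some \<open>b\<close> keeps it above \<open>c\<close>. Continuity from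
  above may fail for such sets, hence the conclusion concerns finitely many coordinates at a
  time.\<close>

lemma bounding_sequence_outer_measure:
  fixes \<alpha> :: "'w \<Rightarrow> nat \<Rightarrow> nat"
  assumes "E \<subseteq> space M" "c < outer_measure_of M E"
  obtains \<beta> where "\<And>m. c < outer_measure_of M {\<omega>\<in>E. \<forall>j<m. \<alpha> \<omega> j \<le> \<beta> j}"
proof -
  \<comment> \<open>The clause for \<open>n = 0\<close> ties the start of the chosen sequence to
    \<open>E\<close>.\<close>
  have "\<exists>G. \<forall>n. ((n = 0 \<longrightarrow> G n = E) \<and> G n \<subseteq> space M \<and> c < outer_measure_of M (G n)) \<and>
      (\<exists>b. G (Suc n) = {\<omega>\<in>G n. \<alpha> \<omega> n \<le> b})"
  proof (rule dependent_nat_choice)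
    fix F :: "'w set" and n :: nat
    assume F: "(n = 0 \<longrightarrow> F = E) \<and> F \<subseteq> space M \<and> c < outer_measure_of M F"
    have "(SUP b. outer_measure_of M {\<omega>\<in>F. \<alpha> \<omega> n \<le> b}) =
        outer_measure_of M (\<Union>b. {\<omega>\<in>F. \<alpha> \<omega> n \<le> b})"
      using F by (intro SUP_outer_measure_of_incseq) (auto simp: incseq_def)
    also have "(\<Union>b. {\<omega>\<in>F. \<alpha> \<omega> n \<le> b}) = F" by auto
    finally obtain b where "c < outer_measure_of M {\<omega>\<in>F. \<alpha> \<omega> n \<le> b}"
      using F by (metis (no_types, lifting) less_SUP_iff)
    with F show "\<exists>G. ((Suc n = 0 \<longrightarrow> G = E) \<and> G \<subseteq> space M \<and> c < outer_measure_of M G) \<and>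
        (\<exists>b. G = {\<omega>\<in>F. \<alpha> \<omega> n \<le> b})"
      by (intro exI[of _ "{\<omega>\<in>F. \<alpha> \<omega> n \<le> b}"]) auto
  qed (use assms in auto)
  then obtain G \<beta> where G: "G 0 = E" "\<And>n. c < outer_measure_of M (G n)"
      "\<And>n. G (Suc n) = {\<omega>\<in>G n. \<alpha> \<omega> n \<le> \<beta> n}"
    by metis
  have G_eq: "G m = {\<omega>\<in>E. \<forall>j<m. \<alpha> \<omega> j \<le> \<beta> j}" for m
    by (induction m) (auto simp: G(1,3) less_Suc_eq)
  show ?thesis by (rule that[of \<beta>]) (fold G_eq, rule G(2))
qed

text \<open>A reverse Fatou bound: the upper limit is the decreasing intersection of the tail
  unions, and a finite measure is continuous from above.\<close>

lemma (in finite_measure) emeasure_infinitely_often_ge: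
  fixes S :: "nat \<Rightarrow> 'a set"
  assumes [measurable]: "\<And>n. S n \<in> sets M" and ge: "\<And>n. c \<le> emeasure M (S n)"
  shows "c \<le> emeasure M {\<omega>\<in>space M. \<exists>\<^sub>\<infinity>n. \<omega> \<in> S n}"
proof -
  have "c \<le> (INF m. emeasure M (\<Union>n\<in>{m..}. S n))"
    by (intro INF_greatest order.trans[OF ge] emeasure_mono) auto
  also have "\<dots> = emeasure M (\<Inter>m. \<Union>n\<in>{m..}. S n)"
    by (intro INF_emeasure_decseq) (auto simp: decseq_def intro: order.trans)
  also have "(\<Inter>m. \<Union>n\<in>{m..}. S n) = {\<omega>\<in>space M. \<exists>\<^sub>\<infinity>n. \<omega> \<in> S n}"
    using sets.sets_into_space[OF assms(1)] by (fastforce simp: INFM_nat_le)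
  finally show ?thesis .
qed

lemma compact_closure_if_totally_bounded:
  fixes S :: "'a::complete_space set"
  assumes "\<And>e. e > 0 \<Longrightarrow> \<exists>k. finite k \<and> S \<subseteq> (\<Union>x\<in>k. ball x e)"
  shows "compact (closure S)"
  unfolding compact_eq_totally_bounded
proof (intro conjI allI impI)
  show "Topological_Spaces.complete (closure S)" by (simp add: complete_eq_closed)
  fix e :: real assume "e > 0"
  then obtain k where k: "finite k" "S \<subseteq> (\<Union>x\<in>k. ball x (e / 2))"
    using assms[of "e / 2"] by auto
  have "closure S \<subseteq> (\<Union>x\<in>k. cball x (e / 2))"
    using k by (intro closure_minimal closed_UN) (fastforce intro: less_imp_le)+
  also have "\<dots> \<subseteq> (\<Union>x\<in>k. ball x e)"
    using \<open>e > 0\<close> by auto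
  finally show "\<exists>k. finite k \<and> closure S \<subseteq> (\<Union>x\<in>k. ball x e)"
    using k(1) by blast
qed

text \<open>With the dense set enumerated by natural numbers, a bound on the index selects finitely
  many points.\<close>

lemma polish_dense_sequence:
  obtains d :: "nat \<Rightarrow> 'x::polish_space"
  where "\<And>U. open U \<Longrightarrow> U \<noteq> {} \<Longrightarrow> \<exists>i. d i \<in> U"
proof -
  obtain D :: "'x set" where D: "countable D" "\<And>U. open U \<Longrightarrow> U \<noteq> {} \<Longrightarrow> \<exists>d\<in>D. d \<in> U"
    using countable_dense_setE by blast
  have "D \<noteq> {}" using D(2)[of UNIV] by auto
  with D have "range (from_nat_into D) = D" by simp
  with D(2) show ?thesis by (intro that[of "from_nat_into D"]) (metis imageE)
qed

section \<open>From attraction of compact sets to locally uniform attraction\<close>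

text \<open>This reduces late times to countably many, for measurability. The rational is taken to
  the right of \<open>t\<close>, so lower bounds on the time survive.\<close>

lemma continuous_on_greater_at_rational:
  fixes h :: "real \<Rightarrow> real"
  assumes "continuous_on {0..} h" "t \<ge> 0" "e < h t"
  shows "\<exists>q\<in>\<rat>. q \<ge> t \<and> e < h q"
proof -
  have "\<forall>\<^sub>F s in at t within {0..}. e < h s"
    using assms by (intro order_tendstoD) (auto simp: continuous_on_def)
  then obtain r where r: "r > 0" "\<And>s. s \<in> {0..} \<Longrightarrow> s \<noteq> t \<Longrightarrow> dist s t < r \<Longrightarrow> e < h s"
    unfolding eventually_at by blast
  obtain q where "q \<in> \<rat>" "t < q" "q < t + r"
    using Rats_dense_in_real[of t "t + r"] r(1) by auto
  with r(2)[of q] assms(2) show ?thesis by (intro bexI[of _ q]) (auto simp: dist_real_def)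
qed

text \<open>If failure had positive outer measure, its witnesses could be confined to one compact
  set \<open>B\<close> violating \<open>unif\<close>. The bound is \<open>\<le> e\<close> so that
  failure is the open condition \<open>e < g\<close>, which persists at nearby dense points and
  rational times.\<close>

lemma (in finite_measure) AE_locally_uniform_if_uniform_on_compacts:
  fixes g :: "real \<Rightarrow> 'a \<Rightarrow> 'x::polish_space \<Rightarrow> real"
  assumes meas: "\<And>t x. t \<ge> 0 \<Longrightarrow> (\<lambda>\<omega>. g t \<omega> x) \<in> borel_measurable M"
    and cont_time: "\<And>\<omega> x. \<omega> \<in> space M \<Longrightarrow> continuous_on {0..} (\<lambda>t. g t \<omega> x)"
    and cont_space: "\<And>\<omega> t. \<omega> \<in> space M \<Longrightarrow> t \<ge> 0 \<Longrightarrow> continuous_on UNIV (g t \<omega>)"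
    and unif: "\<And>B. compact B \<Longrightarrow> AE \<omega> in M. \<forall>\<^sub>F t in at_top. \<forall>x\<in>B. g t \<omega> x \<le> e"
  shows "AE \<omega> in M. \<forall>x. \<forall>\<^sub>F (t, y) in at_top \<times>\<^sub>F nhds x. g t \<omega> y \<le> e"
proof -
  obtain d :: "nat \<Rightarrow> 'x" where d: "\<And>U. open U \<Longrightarrow> U \<noteq> {} \<Longrightarrow> \<exists>i. d i \<in> U"
    by (rule polish_dense_sequence) blast
  define E where "E = {\<omega>\<in>space M. \<exists>x. \<not> (\<forall>\<^sub>F (t, y) in at_top \<times>\<^sub>F nhds x. g t \<omega> y \<le> e)}"
  have E_sub: "E \<subseteq> space M" by (auto simp: E_def)
  have "\<exists>x. \<forall>m. \<exists>i. dist (d i) x < (1/2)^m \<and> (\<exists>q\<in>\<rat>. q \<ge> real m \<and> e < g q \<omega> (d i))"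
    if "\<omega> \<in> E" for \<omega>
  proof -
    from that obtain x where x: "\<not> (\<forall>\<^sub>F (t, y) in at_top \<times>\<^sub>F nhds x. g t \<omega> y \<le> e)"
      and \<omega>: "\<omega> \<in> space M" by (auto simp: E_def)
    have "\<exists>i. dist (d i) x < (1/2)^m \<and> (\<exists>q\<in>\<rat>. q \<ge> real m \<and> e < g q \<omega> (d i))" for m
    proof -
      have ev: "\<forall>\<^sub>F t in at_top. t \<ge> real m" "\<forall>\<^sub>F y in nhds x. y \<in> ball x ((1/2)^m)"
        by (rule eventually_ge_at_top, rule eventually_nhds_in_open) auto
      have "\<exists>t y. t \<ge> real m \<and> y \<in> ball x ((1/2)^m) \<and> e < g t \<omega> y"
      proof (rule ccontr)
        assume "\<not> ?thesis"
        with ev have "\<forall>\<^sub>F (t, y) in at_top \<times>\<^sub>F nhds x. g t \<omega> y \<le> e"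
          unfolding eventually_prod_filter prod.case by (metis not_less)
        with x show False ..
      qed
      then obtain t y where ty: "t \<ge> real m" "y \<in> ball x ((1/2)^m)" "e < g t \<omega> y"
        by blast
      then have "open (ball x ((1/2)^m) \<inter> {z. e < g t \<omega> z})"
        using cont_space[OF \<omega>, of t] by (intro open_Int open_Collect_less) auto
      with ty d obtain i where i: "d i \<in> ball x ((1/2)^m)" "e < g t \<omega> (d i)"
        by blast
      from continuous_on_greater_at_rational[OF cont_time[OF \<omega>] _ i(2)] ty(1)
      obtain q where "q \<in> \<rat>" "q \<ge> t" "e < g q \<omega> (d i)" by auto
      with ty i show ?thesis by (auto simp: dist_commute intro!: exI[of _ i] bexI[of _ q])
    qed
    then show ?thesis by blast
  qed
  \<comment> \<open>\<open>x \<omega>\<close> is a point of failure and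
    \<open>\<alpha> \<omega> m\<close> the index of its \<open>m\<close>-th witness. Both are
    arbitrary choices without measurability in \<open>\<omega>\<close>, whence the outer
    measure.\<close>
  then obtain x \<alpha> where \<alpha>: "\<And>\<omega> m. \<omega> \<in> E \<Longrightarrow> dist (d (\<alpha> \<omega> m)) (x \<omega>) < (1/2)^m"
      "\<And>\<omega> m. \<omega> \<in> E \<Longrightarrow> \<exists>q\<in>\<rat>. q \<ge> real m \<and> e < g q \<omega> (d (\<alpha> \<omega> m))"
    by metis
  have "outer_measure_of M E = 0"
  proof (rule ccontr)
    assume "outer_measure_of M E \<noteq> 0"
    then obtain c where c: "0 < c" "c < outer_measure_of M E"
      using dense[of 0 "outer_measure_of M E"] by (auto simp: zero_less_iff_neq_zero)
    obtain \<beta> where \<beta>: "\<And>m. c < outer_measure_of M {\<omega>\<in>E. \<forall>j<m. \<alpha> \<omega> j \<le> \<beta> j}"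
      using bounding_sequence_outer_measure[OF E_sub c(2)] by blast
    define F where "F j = d ` {..\<beta> j}" for j
    have F_finite: "finite (F j)" for j by (simp add: F_def)
    \<comment> \<open>The distance condition makes the union of the finite sets \<open>Z m\<close> totally bounded.\<close>
    define Z where "Z m = {z\<in>F m. \<forall>j\<le>m. \<exists>y\<in>F j. dist y z < 2 * (1/2)^j}" for m
    have Z_finite: "finite (Z m)" for m using F_finite by (simp add: Z_def)
    define B where "B = closure (\<Union>m. Z m)"
    have "compact B" unfolding B_def
    proof (rule compact_closure_if_totally_bounded)
      fix r :: real assume "r > 0"
      then obtain j where "(1/2)^j < r / 2"
        using real_arch_pow_inv[of "r / 2" "1/2"] by auto
      then have j: "2 * (1/2)^j < r" by simp
      \<comment> \<open>Points of \<open>Z m\<close> with \<open>m \<le> j\<close> are centres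
        themselves; later ones are close to \<open>F j\<close> by definition.\<close>
      have "(\<Union>m. Z m) \<subseteq> (\<Union>x\<in>(\<Union>m\<le>j. F m). ball x r)"
      proof safe
        fix m z assume z: "z \<in> Z m"
        show "z \<in> (\<Union>x\<in>(\<Union>m\<le>j. F m). ball x r)"
        proof (cases "m \<le> j")
          case True
          with z \<open>r > 0\<close> show ?thesis by (force simp: Z_def)
        next
          case False
          then have "j \<le> m" by simp
          with z obtain y where "y \<in> F j" "dist y z < 2 * (1/2)^j" unfolding Z_def by blast
          with j show ?thesis by force
        qed
      qed
      with F_finite show "\<exists>k. finite k \<and> (\<Union>m. Z m) \<subseteq> (\<Union>x\<in>k. ball x r)"
        by (intro exI[of _ "\<Union>m\<le>j. F m"]) auto
    qed
    \<comment> \<open>Finitely many points and rational times make this event measurable, although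
      \<open>E\<close> may not be.\<close>
    define S where "S m = {\<omega>\<in>space M. \<exists>z\<in>Z m. \<exists>q\<in>\<rat> \<inter> {real m..}. e < g q \<omega> z}" for m
    have S_meas: "S m \<in> sets M" for m
    proof -
      have "{\<omega>\<in>space M. e < g q \<omega> z} \<in> sets M" if "q \<in> \<rat> \<inter> {real m..}" for q z
        proof -
        have "q \<ge> 0" using that order.trans[of 0 "real m" q] by simp
        from meas[OF this, of z] show ?thesis by simp
      qed
      then have "(\<Union>z\<in>Z m. \<Union>q\<in>\<rat> \<inter> {real m..}. {\<omega>\<in>space M. e < g q \<omega> z}) \<in> sets M"
        using countable_subset[OF Int_lower1 countable_rat]
        by (intro sets.countable_UN'' countable_finite[OF Z_finite]) auto
      also have "(\<Union>z\<in>Z m. \<Union>q\<in>\<rat> \<inter> {real m..}. {\<omega>\<in>space M. e < g q \<omega> z}) = S m"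
        by (auto simp: S_def)
      finally show ?thesis .
    qed
    \<comment> \<open>Bounds below \<open>Suc m\<close> include the index \<open>m\<close>, so the
      \<open>m\<close>-th witness lies in \<open>F m\<close>; passing through
      \<open>x \<omega>\<close> shows it is also close to all earlier witnesses.\<close>
    have "{\<omega>\<in>E. \<forall>j<Suc m. \<alpha> \<omega> j \<le> \<beta> j} \<subseteq> S m" for m
    proof safe
      fix \<omega> assume \<omega>: "\<omega> \<in> E" "\<forall>j<Suc m. \<alpha> \<omega> j \<le> \<beta> j"
      have "d (\<alpha> \<omega> m) \<in> Z m"
      proof -
        have "dist (d (\<alpha> \<omega> j)) (d (\<alpha> \<omega> m)) < 2 * (1/2)^j" if "j \<le> m" for j
        proof -
          have "(1/2)^m \<le> (1/2::real)^j" using that by (intro power_decreasing) auto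
          with \<alpha>(1)[OF \<omega>(1), of j] \<alpha>(1)[OF \<omega>(1), of m]
            dist_triangle2[of "d (\<alpha> \<omega> j)" "d (\<alpha> \<omega> m)" "x \<omega>"]
          show ?thesis by linarith
        qed
        moreover have "d (\<alpha> \<omega> j) \<in> F j" if "j \<le> m" for j
          using \<omega>(2) that by (simp add: F_def)
        ultimately show ?thesis unfolding Z_def by blast
      qed
      moreover obtain q where "q \<in> \<rat>" "q \<ge> real m" "e < g q \<omega> (d (\<alpha> \<omega> m))"
        using \<alpha>(2)[OF \<omega>(1), of m] by blast
      ultimately show "\<omega> \<in> S m"
        using E_sub \<omega>(1) unfolding S_def by auto
    qed
    then have "c \<le> emeasure M (S m)" for m
      using \<beta>[of "Suc m"] outer_measure_of_mono[of _ "S m" M] S_meas[of m]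
      by (metis (no_types, lifting) less_imp_le order_less_le_trans outer_measure_of_eq)
    then have "c \<le> emeasure M {\<omega>\<in>space M. \<exists>\<^sub>\<infinity>m. \<omega> \<in> S m}"
      by (intro emeasure_infinitely_often_ge S_meas)
    \<comment> \<open>Once \<open>m\<close> exceeds the threshold time that \<open>unif\<close>
      provides for \<open>B\<close>, the event \<open>S m\<close> is impossible.\<close>
    moreover have "AE \<omega> in M. \<not> (\<exists>\<^sub>\<infinity>m. \<omega> \<in> S m)"
      using unif[OF \<open>compact B\<close>]
    proof eventually_elim
      case (elim \<omega>)
      then obtain T where T: "\<And>t x. t \<ge> T \<Longrightarrow> x \<in> B \<Longrightarrow> g t \<omega> x \<le> e"
        by (auto simp: eventually_at_top_linorder)
      have "\<omega> \<notin> S m" if "m \<ge> nat \<lceil>T\<rceil>" for m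
      proof
        assume "\<omega> \<in> S m"
        then obtain z q where zq: "z \<in> Z m" "q \<ge> real m" "e < g q \<omega> z"
          unfolding S_def by blast
        have "z \<in> B" using zq(1) closure_subset[of "\<Union>m. Z m"] unfolding B_def by blast
        moreover have "q \<ge> T" using that zq(2) by linarith
        ultimately show False using T zq(3) by (simp add: leD)
      qed
      then show ?case unfolding INFM_nat_le by blast
    qed
    then have "emeasure M {\<omega>\<in>space M. \<exists>\<^sub>\<infinity>m. \<omega> \<in> S m} = 0"
      by (intro emeasure_eq_0_AE)
    ultimately show False using c(1) by simp
  qed
  \<comment> \<open>A measurable cover of \<open>E\<close> with the same outer measure is the
    required nullset.\<close>
  with outer_measure_of_attain[OF E_sub] obtain N where "N \<in> null_sets M" "E \<subseteq> N"
    by auto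
  then show ?thesis by (intro AE_I'[of N]) (auto simp: E_def)
qed

section \<open>Measurability and tightness of random compact sets\<close>

text \<open>A point of \<open>A\<close> at distance \<open>r\<close> from \<open>K\<close> is
  detected by a dense point within \<open>r / 2\<close> of it. Inclusion thus becomes a countable
  condition on distances.\<close>

lemma subset_iff_infdist_le_on_dense:
  fixes d :: "nat \<Rightarrow> 'x::metric_space"
  assumes d: "\<And>U. open U \<Longrightarrow> U \<noteq> {} \<Longrightarrow> \<exists>i. d i \<in> U"
    and "closed K" "K \<noteq> {}" "A \<noteq> {}"
  shows "A \<subseteq> K \<longleftrightarrow> (\<forall>i. infdist (d i) K \<le> infdist (d i) A)"
proof
  assume "A \<subseteq> K"
  then show "\<forall>i. infdist (d i) K \<le> infdist (d i) A"
    using infdist_mono assms(4) by blast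
next
  assume le: "\<forall>i. infdist (d i) K \<le> infdist (d i) A"
  show "A \<subseteq> K"
  proof (rule ccontr)
    assume "\<not> A \<subseteq> K"
    then obtain a where a: "a \<in> A" "a \<notin> K" by blast
    define r where "r = infdist a K"
    have "r > 0" using a assms infdist_pos_not_in_closed by (auto simp: r_def)
    then obtain i where "d i \<in> ball a (r / 2)" using d[of "ball a (r / 2)"] by auto
    then have *: "dist (d i) a < r / 2" by (simp add: dist_commute)
    have "r \<le> infdist (d i) K + dist a (d i)"
      unfolding r_def by (rule infdist_triangle)
    moreover have "infdist (d i) A \<le> dist (d i) a" using a by (intro infdist_le)
    ultimately show False using * le[rule_format, of i] by (simp add: dist_commute)
  qed
qed

lemma measurable_random_set_subset:
  fixes A :: "'w \<Rightarrow> 'x::polish_space set"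
  assumes A: "random_compact_set M A" and "closed K"
  shows "{\<omega>\<in>space M. A \<omega> \<subseteq> K} \<in> sets M"
\<comment> \<open>The distance criterion breaks down for empty \<open>K\<close>, where
  \<open>infdist\<close> is 0; that case is settled by nonemptiness of
  \<open>A \<omega>\<close>.\<close>
proof (cases "K = {}")
  case True
  with A have "{\<omega>\<in>space M. A \<omega> \<subseteq> K} = {}"
    by (auto simp: random_compact_set_def)
  then show ?thesis by (metis sets.empty_sets)
next
  case False
  obtain d :: "nat \<Rightarrow> 'x" where d: "\<And>U. open U \<Longrightarrow> U \<noteq> {} \<Longrightarrow> \<exists>i. d i \<in> U"
    by (rule polish_dense_sequence) blast
  have [measurable]: "(\<lambda>\<omega>. infdist x (A \<omega>)) \<in> borel_measurable M" for x
    using A by (simp add: random_compact_set_def)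
  have "{\<omega>\<in>space M. A \<omega> \<subseteq> K} = {\<omega>\<in>space M. \<forall>i. infdist (d i) K \<le> infdist (d i) (A \<omega>)}"
    using subset_iff_infdist_le_on_dense[OF d \<open>closed K\<close> False] A
    by (auto simp: random_compact_set_def)
  also have "\<dots> \<in> sets M" by measurable
  finally show ?thesis .
qed

text \<open>Measurability is given only at fixed points. The distance from a moving point is the
  infimum of \<open>dist y (d i) + infdist (d i) B\<close> over the dense sequence.\<close>

lemma measurable_infdist_random_set:
  fixes A :: "'w \<Rightarrow> 'x::polish_space set"
  assumes A: "random_compact_set M A" and [measurable]: "Y \<in> borel_measurable M"
  shows "(\<lambda>\<omega>. infdist (Y \<omega>) (A \<omega>)) \<in> borel_measurable M"
proof (rule borel_measurableI_less)
  fix r :: real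
  obtain d :: "nat \<Rightarrow> 'x" where d: "\<And>U. open U \<Longrightarrow> U \<noteq> {} \<Longrightarrow> \<exists>i. d i \<in> U"
    by (rule polish_dense_sequence) blast
  have [measurable]: "(\<lambda>\<omega>. infdist x (A \<omega>)) \<in> borel_measurable M" for x
    using A by (simp add: random_compact_set_def)
  have "infdist y B < r \<longleftrightarrow> (\<exists>i. dist y (d i) + infdist (d i) B < r)" for y and B :: "'x set"
  proof
    assume less: "infdist y B < r"
    define s where "s = (r - infdist y B) / 2"
    have "s > 0" using less by (simp add: s_def)
    then obtain i where "d i \<in> ball y s" using d[of "ball y s"] by auto
    moreover have "infdist (d i) B \<le> infdist y B + dist (d i) y" by (rule infdist_triangle)
    ultimately have "dist y (d i) + infdist (d i) B < r"
      by (simp add: s_def dist_commute field_simps)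
    then show "\<exists>i. dist y (d i) + infdist (d i) B < r" ..
  next
    assume "\<exists>i. dist y (d i) + infdist (d i) B < r"
    then obtain i where "dist y (d i) + infdist (d i) B < r" ..
    with infdist_triangle[of y B "d i"] show "infdist y B < r" by linarith
  qed
  then have "{\<omega>\<in>space M. infdist (Y \<omega>) (A \<omega>) < r} =
      {\<omega>\<in>space M. \<exists>i. dist (Y \<omega>) (d i) + infdist (d i) (A \<omega>) < r}"
    by simp
  also have "\<dots> \<in> sets M" by measurable
  finally show "{\<omega>\<in>space M. infdist (Y \<omega>) (A \<omega>) < r} \<in> sets M" .
qed

text \<open>The argument of Ulam's theorem: for each radius finitely many balls cover
  \<open>A \<omega>\<close>, and bounding their numbers uniformly in \<open>\<omega>\<close> leaves
  a closed, totally bounded set \<open>K\<close>.\<close>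

lemma random_compact_set_tight:
  fixes A :: "'w \<Rightarrow> 'x::polish_space set"
  assumes "finite_measure M" and A: "random_compact_set M A" and c: "c < emeasure M (space M)"
  obtains K where "compact K" "c \<le> emeasure M {\<omega>\<in>space M. A \<omega> \<subseteq> K}"
proof -
  interpret finite_measure M by fact
  obtain d :: "nat \<Rightarrow> 'x" where d: "\<And>U. open U \<Longrightarrow> U \<noteq> {} \<Longrightarrow> \<exists>i. d i \<in> U"
    by (rule polish_dense_sequence) blast
  from A have AE_compact: "AE \<omega> in M. compact (A \<omega>)" by (simp add: random_compact_set_def)
  then obtain N where N: "{\<omega>\<in>space M. \<not> compact (A \<omega>)} \<subseteq> N" "emeasure M N = 0" "N \<in> sets M"
    by (rule AE_E)
  define E where "E = space M - N"
  have E: "E \<in> sets M" "\<And>\<omega>. \<omega> \<in> E \<Longrightarrow> compact (A \<omega>)"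
    using N by (auto simp: E_def)
  have "emeasure M E = emeasure M (space M)"
    unfolding E_def by (rule emeasure_Diff_null_set) (use N in auto)
  then have c': "c < outer_measure_of M E" using E(1) c by simp
  define F where "F j n = (\<Union>i\<le>n. cball (d i) ((1/2)^j))" for j n :: nat
  have F_closed: "closed (F j n)" for j n
    by (auto simp: F_def intro!: closed_UN)
  have "\<exists>n. A \<omega> \<subseteq> F j n" if \<omega>: "\<omega> \<in> E" for \<omega> j
  proof -
    have "A \<omega> \<subseteq> (\<Union>i. ball (d i) ((1/2)^j))"
    proof
      fix x :: 'x
      have "(1/2::real)^j > 0" by simp
      then have "x \<in> ball x ((1/2)^j)" by simp
      then obtain i where "d i \<in> ball x ((1/2)^j)" using d[OF open_ball, of x] by blast
      then show "x \<in> (\<Union>i. ball (d i) ((1/2)^j))" by (auto simp: dist_commute)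
    qed
    then obtain I where "finite I" "A \<omega> \<subseteq> (\<Union>i\<in>I. ball (d i) ((1/2)^j))"
      using compactE_image[OF E(2)[OF \<omega>], of UNIV "\<lambda>i. ball (d i) ((1/2)^j)"] by auto
    moreover have "(\<Union>i\<in>I. ball (d i) ((1/2)^j)) \<subseteq> F j (Max I)"
      unfolding F_def using \<open>finite I\<close> by (intro UN_mono) auto
    ultimately show ?thesis by blast
  qed
  then obtain \<alpha> where \<alpha>: "\<And>\<omega> j. \<omega> \<in> E \<Longrightarrow> A \<omega> \<subseteq> F j (\<alpha> \<omega> j)" by metis
  obtain \<beta> where \<beta>: "\<And>m. c < outer_measure_of M {\<omega>\<in>E. \<forall>j<m. \<alpha> \<omega> j \<le> \<beta> j}"
    using bounding_sequence_outer_measure[OF sets.sets_into_space[OF E(1)] c'] by blast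
  define K where "K = (\<Inter>j. F j (\<beta> j))"
  have "closed K" using F_closed by (auto simp: K_def)
  have "compact (closure K)"
  proof (rule compact_closure_if_totally_bounded)
    fix e :: real assume "e > 0"
    then obtain j where j: "(1/2)^j < e"
      using real_arch_pow_inv[of e "1/2"] by auto
    have "K \<subseteq> F j (\<beta> j)" by (auto simp: K_def)
    also have "\<dots> \<subseteq> (\<Union>x\<in>d ` {..\<beta> j}. ball x e)"
      unfolding F_def UN_simps by (intro UN_mono) (use j in auto)
    finally show "\<exists>k. finite k \<and> K \<subseteq> (\<Union>x\<in>k. ball x e)" by blast
  qed
  then have "compact K" using \<open>closed K\<close> by simp
  \<comment> \<open>These events impose finitely many constraints; being measurable and decreasing,
    they allow continuity from above to pass to \<open>K\<close>.\<close>
  define S where "S m = {\<omega>\<in>space M. A \<omega> \<subseteq> (\<Inter>j<m. F j (\<beta> j))}" for m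
  have S_meas: "S m \<in> sets M" for m
    unfolding S_def by (intro measurable_random_set_subset[OF A] closed_INT) (simp add: F_closed)
  have "c \<le> emeasure M (S m)" for m
  proof -
    have "F j n \<subseteq> F j n'" if "n \<le> n'" for j n n'
      unfolding F_def using that by (intro UN_mono) auto
    then have "{\<omega>\<in>E. \<forall>j<m. \<alpha> \<omega> j \<le> \<beta> j} \<subseteq> S m"
      using \<alpha> sets.sets_into_space[OF E(1)] unfolding S_def by blast
    from order.strict_trans2[OF \<beta>[of m] outer_measure_of_mono[OF this]] S_meas
    show ?thesis by simp
  qed
  then have "c \<le> (INF m. emeasure M (S m))" by (intro INF_greatest)
  also have "\<dots> = emeasure M (\<Inter>m. S m)"
    using S_meas by (intro INF_emeasure_decseq) (auto simp: decseq_def S_def)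
  also have "(\<Inter>m. S m) = {\<omega>\<in>space M. A \<omega> \<subseteq> K}"
    by (auto simp: S_def K_def)
  finally show ?thesis using \<open>compact K\<close> by (rule that[rotated])
qed

section \<open>Recurrence under the measure-preserving shift\<close>

context metric_dynamical_system
begin

lemma shift_measurable [measurable]: "\<theta> t \<in> measurable M M"
  using measurable_compose[OF measurable_Pair1' measurable_shift, of t] by simp

lemma shift_cancel: "\<omega> \<in> space M \<Longrightarrow> \<theta> t (\<theta> (- t) \<omega>) = \<omega>"
  using shift_add[of \<omega> t "- t"] shift_0 by simp

lemma AE_shift: "AE \<omega> in M. P \<omega> \<Longrightarrow> AE \<omega> in M. P (\<theta> t \<omega>)"
  using AE_distrD[OF shift_measurable, where P = P and t1 = t] by (simp only: shift_invariant)

text \<open>By invariance, inclusion in a tight compact set has the same large probability at every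
  time, hence occurs infinitely often with at least that probability. Countably many compact sets
  push the probability to 1, so \<open>K\<close> depends on \<open>\<omega>\<close>.\<close>

lemma AE_random_compact_set_recurs_in_compact:
  fixes A :: "'w \<Rightarrow> 'x::polish_space set"
  assumes A: "random_compact_set M A"
  shows "AE \<omega> in M. \<exists>K. compact K \<and> (\<exists>\<^sub>\<infinity>n. A (\<theta> (- real n) \<omega>) \<subseteq> K)"
proof -
  \<comment> \<open>The level is strictly below 1, as tightness requires, and is trivially 0 for
    \<open>k = 0\<close>.\<close>
  have "\<exists>K. compact K \<and> ennreal (1 - 1 / Suc k) \<le> emeasure M {\<omega>\<in>space M. A \<omega> \<subseteq> K}" for k
    by (rule random_compact_set_tight[OF finite_measure_axioms A, of "ennreal (1 - 1 / Suc k)"])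
       (auto simp: emeasure_space_1 ennreal_less_one_iff)
  then obtain K where K: "\<And>k. compact (K k)"
      "\<And>k. ennreal (1 - 1 / Suc k) \<le> emeasure M {\<omega>\<in>space M. A \<omega> \<subseteq> K k}"
    by metis
  have meas: "{\<omega>\<in>space M. A \<omega> \<subseteq> K k} \<in> sets M" for k
    by (intro measurable_random_set_subset[OF A] compact_imp_closed K)
  define S where "S k n = \<theta> (- real n) -` {\<omega>\<in>space M. A \<omega> \<subseteq> K k} \<inter> space M" for k and n :: nat
  have [measurable]: "S k n \<in> sets M" for k n
    unfolding S_def by (intro measurable_sets[OF shift_measurable] meas)
  have "emeasure M (S k n) = emeasure M {\<omega>\<in>space M. A \<omega> \<subseteq> K k}" for k n
    unfolding S_def using emeasure_distr[OF shift_measurable meas, of "- real n" k]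
    by (simp add: shift_invariant)
  then have ge: "ennreal (1 - 1 / Suc k) \<le> emeasure M {\<omega>\<in>space M. \<exists>\<^sub>\<infinity>n. \<omega> \<in> S k n}" for k
    using K(2) by (intro emeasure_infinitely_often_ge) auto
  define L where "L = {\<omega>\<in>space M. \<exists>k. \<exists>\<^sub>\<infinity>n. \<omega> \<in> S k n}"
  have [measurable]: "L \<in> sets M" unfolding L_def INFM_nat_le by measurable
  have "1 - 1 / Suc k \<le> prob L" for k
  proof -
    have "{\<omega>\<in>space M. \<exists>\<^sub>\<infinity>n. \<omega> \<in> S k n} \<subseteq> L" by (auto simp: L_def)
    then have "ennreal (1 - 1 / Suc k) \<le> emeasure M L"
      by (intro order.trans[OF ge] emeasure_mono) auto
    then show ?thesis by (simp add: emeasure_eq_measure)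
  qed
  moreover have "(\<lambda>k. 1 - 1 / real (Suc k)) \<longlonglongrightarrow> 1 - 0"
    by (intro tendsto_intros lim_1_over_n[THEN LIMSEQ_Suc])
  ultimately have "1 \<le> prob L" by (intro LIMSEQ_le_const2) auto
  then have "AE \<omega> in M. \<omega> \<in> L" by (intro AE_prob_1) (simp add: antisym)
  then show ?thesis
  proof eventually_elim
    case (elim \<omega>)
    then obtain k where "\<exists>\<^sub>\<infinity>n. \<omega> \<in> S k n" by (auto simp: L_def)
    then have "\<exists>\<^sub>\<infinity>n. A (\<theta> (- real n) \<omega>) \<subseteq> K k"
      by (rule INFM_mono) (auto simp: S_def)
    with K(1) show ?case by blast
  qed
qed

end

section \<open>Invariance and attraction in pullback form\<close>

context random_dynamical_system
begin

lemma pullback_measurable: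
  assumes "t \<ge> 0"
  shows "(\<lambda>\<omega>. \<phi> t (\<theta> (- t) \<omega>) x) \<in> borel_measurable M"
proof -
  have "(\<lambda>\<omega>. (t, \<theta> (- t) \<omega>, x)) \<in> measurable M (restrict_space borel {0..} \<Otimes>\<^sub>M (M \<Otimes>\<^sub>M borel))"
    using assms by (intro measurable_Pair measurable_const) (auto simp: space_restrict_space)
  from measurable_compose[OF this measurable_cocycle] show ?thesis by simp
qed

text \<open>Invariance is evaluated at \<open>\<theta> (- t) \<omega>\<close>, which is legitimate
  almost everywhere because the shift preserves nullsets. The exceptional set depends on
  \<open>t\<close>.\<close>

lemma AE_attractor_eq_pullback_image:
  assumes "invariant_random_set M \<theta> \<phi> A" "t \<ge> 0"
  shows "AE \<omega> in M. \<phi> t (\<theta> (- t) \<omega>) ` A (\<theta> (- t) \<omega>) = A \<omega>"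
proof -
  from assms have "AE \<omega> in M. \<phi> t \<omega> ` A \<omega> = A (\<theta> t \<omega>)"
    by (simp add: invariant_random_set_def)
  from AE_shift[OF this, of "- t"] AE_space show ?thesis
    by eventually_elim (simp add: shift_cancel)
qed

lemma AE_pullback_attractor_locally_uniform:
  assumes cont: "pullback_continuous M \<theta> \<phi>" and attr: "pullback_attractor M \<theta> \<phi> A"
  shows "AE \<omega> in M. \<forall>x e. e > 0 \<longrightarrow>
    (\<forall>\<^sub>F (t, y) in at_top \<times>\<^sub>F nhds x. infdist (\<phi> t (\<theta> (- t) \<omega>) y) (A \<omega>) < e)"
proof -
  define g where "g t \<omega> x = infdist (\<phi> t (\<theta> (- t) \<omega>) x) (A \<omega>)" for t \<omega> x
  have loc: "AE \<omega> in M. \<forall>x. \<forall>\<^sub>F (t, y) in at_top \<times>\<^sub>F nhds x. g t \<omega> y \<le> e" if "e > 0" for e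
  proof (rule AE_locally_uniform_if_uniform_on_compacts)
    show "(\<lambda>\<omega>. g t \<omega> x) \<in> borel_measurable M" if "t \<ge> 0" for t x
      unfolding g_def using attr pullback_measurable[OF that]
      by (intro measurable_infdist_random_set) (auto simp: pullback_attractor_def)
    show "continuous_on {0..} (\<lambda>t. g t \<omega> x)" if "\<omega> \<in> space M" for \<omega> x
      unfolding g_def using cont that
      by (intro continuous_intros) (auto simp: pullback_continuous_def)
    show "continuous_on UNIV (g t \<omega>)" if "\<omega> \<in> space M" "t \<ge> 0" for \<omega> t
      unfolding g_def
      by (intro continuous_on_infdist cocycle_continuous that measurable_space[OF shift_measurable])
    show "AE \<omega> in M. \<forall>\<^sub>F t in at_top. \<forall>x\<in>B. g t \<omega> x \<le> e" if "compact B" for B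
    proof -
      from attr that have "AE \<omega> in M. ((\<lambda>t. SUP x\<in>B. ennreal (g t \<omega> x)) \<longlongrightarrow> 0) at_top"
        by (simp add: pullback_attractor_def g_def)
      then show ?thesis
      proof eventually_elim
        case (elim \<omega>)
        have "\<forall>\<^sub>F t in at_top. (SUP x\<in>B. ennreal (g t \<omega> x)) < ennreal e"
          by (rule order_tendstoD(2)[OF elim]) (use \<open>e > 0\<close> in simp)
        then show ?case
        proof eventually_elim
          case (elim t)
          show ?case
          proof
            fix x assume "x \<in> B"
            then have "ennreal (g t \<omega> x) \<le> (SUP x\<in>B. ennreal (g t \<omega> x))" by (rule SUP_upper)
            with elim have "ennreal (g t \<omega> x) < ennreal e" by (rule le_less_trans[rotated])
            then show "g t \<omega> x \<le> e"
              using ennreal_leI leD by (meson linear)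
          qed
        qed
      qed
    qed
  qed
  \<comment> \<open>Countably many tolerances yield a single nullset valid for every
    \<open>e\<close>.\<close>
  have "AE \<omega> in M. \<forall>n. \<forall>x. \<forall>\<^sub>F (t, y) in at_top \<times>\<^sub>F nhds x. g t \<omega> y \<le> 1 / real (Suc n)"
    unfolding AE_all_countable by (intro allI loc) simp
  then show ?thesis
  proof eventually_elim
    case (elim \<omega>)
    show ?case
    proof (intro allI impI)
      fix x and e :: real assume "e > 0"
      then obtain n where n: "1 / real (Suc n) < e" using nat_approx_posE by blast
      from elim have "\<forall>\<^sub>F (t, y) in at_top \<times>\<^sub>F nhds x. g t \<omega> y \<le> 1 / real (Suc n)" by blast
      then show "\<forall>\<^sub>F (t, y) in at_top \<times>\<^sub>F nhds x. infdist (\<phi> t (\<theta> (- t) \<omega>) y) (A \<omega>) < e"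
        by eventually_elim (use n in \<open>auto simp: g_def\<close>)
    qed
  qed
qed

end

theorem theorem3p4:
  fixes M :: "'w measure"
    and \<theta> :: "real \<Rightarrow> 'w \<Rightarrow> 'w"
    and \<phi> :: "real \<Rightarrow> 'w \<Rightarrow> 'x::polish_space \<Rightarrow> 'x"
    and A :: "'w \<Rightarrow> 'x set"
  assumes "connected (UNIV :: 'x set)"
    and "random_dynamical_system M \<theta> \<phi>"
    and "pullback_continuous M \<theta> \<phi>"
    and "pullback_attractor M \<theta> \<phi> A"
  shows "AE \<omega> in M. connected (A \<omega>)"
proof -
  interpret random_dynamical_system M \<theta> \<phi> by fact
  have A: "random_compact_set M A" "invariant_random_set M \<theta> \<phi> A"
    using assms(4) by (auto simp: pullback_attractor_def)
  have "AE \<omega> in M. compact (A \<omega>)"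
    using A(1) by (simp add: random_compact_set_def)
  \<comment> \<open>Restricting to natural times unites the exceptional sets into one
    nullset.\<close>
  moreover have "AE \<omega> in M. \<forall>n. \<phi> (real n) (\<theta> (- real n) \<omega>) ` A (\<theta> (- real n) \<omega>) = A \<omega>"
    unfolding AE_all_countable by (intro allI AE_attractor_eq_pullback_image A) simp
  moreover note AE_random_compact_set_recurs_in_compact[OF A(1)]
    AE_pullback_attractor_locally_uniform[OF assms(3,4)] AE_space
  ultimately show ?thesis
  proof eventually_elim
    case (elim \<omega>)
    then obtain K where K: "compact K" "\<exists>\<^sub>\<infinity>n. A (\<theta> (- real n) \<omega>) \<subseteq> K" by blast
    have "\<exists>\<^sub>F n in sequentially. A \<omega> \<subseteq> \<phi> (real n) (\<theta> (- real n) \<omega>) ` K"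
      using K(2) unfolding cofinite_eq_sequentially
      by (rule frequently_elim1) (use elim(2) in blast)
    \<comment> \<open>Since \<open>real n\<close> tends to infinity, recurrence along natural times
      gives recurrence in continuous time.\<close>
    then have recur: "\<exists>\<^sub>F t in at_top. A \<omega> \<subseteq> \<phi> t (\<theta> (- t) \<omega>) ` K"
      unfolding frequently_def
      using eventually_compose_filterlim[OF _ filterlim_real_sequentially] by blast
    show ?case
    proof (rule connected_if_locally_uniformly_attracting[OF assms(1) elim(1) _ _ _ K(1) recur])
      show "continuous_on {0..} (\<lambda>t. \<phi> t (\<theta> (- t) \<omega>) x)" for x
        using assms(3) elim(5) by (simp add: pullback_continuous_def)
      show "continuous_on UNIV (\<phi> t (\<theta> (- t) \<omega>))" if "t \<ge> 0" for t
        by (intro cocycle_continuous that measurable_space[OF shift_measurable] elim(5))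
    qed (use elim(4) in blast)
  qed
qed

end
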